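(* Let $n, k \ge 0$ be integers. In the game Mem$^+$, the nim value $\mathcal{G}(n_k)$ is the largest integer $m$ for which $$mk+\frac{m(m+1)}{2}\le n.$$
   Context: Mem$^+$ is an impartial game (normal play) on a heap of tokens. A position $n_k$ (integers $n,k\ge 0$) is a heap of $n$ tokens with memory $k$, where $k$ is the number of tokens removed by the immediately preceding move on the heap ($k=0$ for an untouched heap). From $n_k$ a player may move to $(n-j)_j$ for any integer $j$ with $k<j\le n$; there are no other moves. The nim value $\mathcal{G}$ is defined recursively by $\mathcal{G}(n_k)=\operatorname{mex}\{\mathcal{G}((n-j)_j) : k<j\le n\}$, where $\operatorname{mex}(S)$ is the least nonnegative integer not in $S$. *)

theory Defs
  imports Complex_Main
begin

definition mex :: "nat set \<Rightarrow> nat" where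
  "mex S = (LEAST v. v \<notin> S)"

text \<open>The pair \<open>(n, k)\<close> encodes the position \<open>n\<^sub>k\<close>: a heap of \<open>n\<close> tokens with memory \<open>k\<close>.\<close>

type_synonym position = "nat \<times> nat"

definition mem_plus_moves :: "position \<Rightarrow> position set" where
  "mem_plus_moves = (\<lambda>(n, k). (\<lambda>j. (n - j, j)) ` {j. k < j \<and> j \<le> n})"

function nim_value :: "position \<Rightarrow> nat" where
  "nim_value p = mex (nim_value ` mem_plus_moves p)"
  by pat_completeness auto
termination
  by (relation "measure fst") (auto simp: mem_plus_moves_def)

text \<open>The defining equation is unconditional and would make the simplifier loop.\<close>

declare nim_value.simps [simp del]

end

theory Submission
  imports Defs
begin

text \<open>
  Successive moves on a heap with memory \<open>k\<close> remove strictly increasing numbers of tokens, all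
  greater than \<open>k\<close>, so \<open>m\<close> moves in a row use up at least \<open>(k+1) + \<dots> + (k+m)\<close> tokens, which is
  \<open>m k + m (m + 1) / 2\<close>.  The theorem thus says that the nim value of a position is the length
  of the longest play from it.

  Write \<open>c m k\<close> for this sum.  By induction on the heap, \<open>m \<le> \<G>(n\<^sub>k)\<close> holds exactly when
  \<open>c m k \<le> n\<close> (lemma \<open>le_nim_value_iff\<close>).  One half is that a move shortens the longest
  play.  The other half is that every smaller length \<open>v\<close> is the exact longest length
  after some move: among the moves \<open>j\<close> that leave room for \<open>v\<close> further ones, the largest leaves
  no room for \<open>v + 1\<close>, because it satisfies \<open>n < (j + 1) + c v (j + 1) = c (v + 1) j\<close>.
\<close>

lemma le_mex_iff:
  assumes "finite S"
  shows "m \<le> mex S \<longleftrightarrow> (\<forall>v<m. v \<in> S)"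
proof
  assume "m \<le> mex S"
  then show "\<forall>v<m. v \<in> S"
    unfolding mex_def by (meson less_le_trans not_less_Least)
next
  assume *: "\<forall>v<m. v \<in> S"
  have "\<exists>v. v \<notin> S"
    using assms ex_new_if_finite infinite_UNIV_nat by blast
  then have "mex S \<notin> S"
    unfolding mex_def by (metis LeastI)
  with * show "m \<le> mex S"
    using leI by blast
qed

lemma mem_nim_value_moves_iff:
  "v \<in> nim_value ` mem_plus_moves (n, k) \<longleftrightarrow> (\<exists>j. k < j \<and> j \<le> n \<and> nim_value (n - j, j) = v)"
  by (auto simp: mem_plus_moves_def)

lemma le_nim_value_iff_moves:
  "m \<le> nim_value (n, k) \<longleftrightarrow> (\<forall>v<m. \<exists>j. k < j \<and> j \<le> n \<and> nim_value (n - j, j) = v)"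
proof -
  have "finite (mem_plus_moves (n, k))"
    by (auto simp: mem_plus_moves_def)
  then show ?thesis
    by (subst nim_value.simps) (simp add: le_mex_iff mem_nim_value_moves_iff)
qed

text \<open>
  The least number of tokens used by \<open>m\<close> moves in a row from memory \<open>k\<close>, attained by
  removing \<open>k + 1, \<dots>, k + m\<close> tokens in turn.
\<close>

definition play_cost :: "nat \<Rightarrow> nat \<Rightarrow> nat" where
  "play_cost m k = (\<Sum>i<m. k + Suc i)"

lemma play_cost_0 [simp]: "play_cost 0 k = 0"
  by (simp add: play_cost_def)

lemma play_cost_Suc: "play_cost (Suc m) k = Suc k + play_cost m (Suc k)"
  by (simp add: play_cost_def sum.lessThan_Suc_shift del: sum.lessThan_Suc)

lemma play_cost_mono: "k \<le> l \<Longrightarrow> play_cost m k \<le> play_cost m l"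
  by (simp add: play_cost_def sum_mono)

lemma double_play_cost: "2 * play_cost m k = 2 * (m * k) + m * (m + 1)"
  by (induction m) (simp_all add: play_cost_def algebra_simps)

text \<open>
  The witness is the largest \<open>j\<close> that still leaves tokens for \<open>v\<close> further moves.  The hypothesis
  says that \<open>Suc k\<close> is one such \<open>j\<close>, so the largest is a legal move, and its successor
  fails: by \<open>play_cost_Suc\<close> this is \<open>n < play_cost (Suc v) j\<close>, which excludes \<open>Suc v\<close> moves after \<open>j\<close>.
\<close>

lemma ex_move_leaving_exactly:
  assumes "play_cost (Suc v) k \<le> n"
  shows "\<exists>j. k < j \<and> j + play_cost v j \<le> n \<and> n < j + play_cost (Suc v) j"
proof -
  let ?Q = "\<lambda>j. j + play_cost v j \<le> n"
  have first: "?Q (Suc k)"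
    using assms by (simp add: play_cost_Suc)
  define j where "j = (GREATEST j. ?Q j)"
  have bound: "i \<le> n" if "?Q i" for i
    using that by simp
  have "?Q j"
    unfolding j_def by (rule GreatestI_nat[of ?Q, OF first bound])
  moreover have "Suc k \<le> j"
    unfolding j_def by (rule Greatest_le_nat[of ?Q, OF first bound])
  moreover have "\<not> ?Q (Suc j)"
    using Greatest_le_nat[of ?Q "Suc j" n] bound unfolding j_def by fastforce
  ultimately show ?thesis
    by (intro exI[of _ j]) (simp add: play_cost_Suc)
qed

text \<open>
  Stating the nim value through its lower bounds \<open>m\<close> matches both the description of a mex by
  the values below it and the threshold \<open>play_cost m k \<le> n\<close>, so that the induction
  hypothesis turns \<open>\<G>((n-j)\<^sub>j) = v\<close> into a pair of inequalities.
\<close>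

lemma le_nim_value_iff: "m \<le> nim_value (n, k) \<longleftrightarrow> play_cost m k \<le> n"
proof (induction n arbitrary: m k rule: less_induct)
  case (less n)
  have option_value: "nim_value (n - j, j) = v \<longleftrightarrow>
      j + play_cost v j \<le> n \<and> n < j + play_cost (Suc v) j"
    if "k < j" "j \<le> n" for j v
  proof -
    have IH: "u \<le> nim_value (n - j, j) \<longleftrightarrow> play_cost u j \<le> n - j" for u
      using that by (intro less.IH) simp
    have "nim_value (n - j, j) = v \<longleftrightarrow>
        v \<le> nim_value (n - j, j) \<and> \<not> Suc v \<le> nim_value (n - j, j)"
      by auto
    then show ?thesis
      unfolding IH using \<open>j \<le> n\<close> by auto
  qed
  show ?case
  proof
    assume m: "m \<le> nim_value (n, k)"
    show "play_cost m k \<le> n"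
    proof (cases m)
      case (Suc v)
      with m obtain j where j: "k < j" "j \<le> n" "nim_value (n - j, j) = v"
        unfolding le_nim_value_iff_moves by blast
      have "play_cost m k \<le> j + play_cost v j"
        using j(1) play_cost_mono[of "Suc k" j v] by (simp add: Suc play_cost_Suc)
      also have "\<dots> \<le> n"
        using option_value j by blast
      finally show ?thesis .
    qed simp
  next
    assume m: "play_cost m k \<le> n"
    show "m \<le> nim_value (n, k)"
      unfolding le_nim_value_iff_moves
    proof (intro allI impI)
      fix v assume "v < m"
      then have "play_cost (Suc v) k \<le> play_cost m k"
        unfolding play_cost_def by (intro sum_mono2) auto
      then obtain j where "k < j" "j + play_cost v j \<le> n" "n < j + play_cost (Suc v) j"
        using m ex_move_leaving_exactly[of v k n] by auto
      then show "\<exists>j. k < j \<and> j \<le> n \<and> nim_value (n - j, j) = v"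
        using option_value[of j v] by (intro exI[of _ j]) simp
    qed
  qed
qed

theorem theorem2p1:
  fixes n k :: nat
  defines "P \<equiv> (\<lambda>m::int. real_of_int m * real k + real_of_int m * (real_of_int m + 1) / 2 \<le> real n)"
  shows "P (int (nim_value (n, k))) \<and> (\<forall>m. P m \<longrightarrow> m \<le> int (nim_value (n, k)))"
proof -
  have P_iff: "P (int m) \<longleftrightarrow> m \<le> nim_value (n, k)" for m
  proof -
    have "2 * real (play_cost m k) = 2 * (real m * real k) + real m * (real m + 1)"
      using arg_cong[OF double_play_cost[of m k], of real] by (simp add: algebra_simps)
    then have "P (int m) \<longleftrightarrow> real (play_cost m k) \<le> real n"
      unfolding P_def by auto
    then show ?thesis
      by (simp add: le_nim_value_iff)
  qed
  have "m \<le> int (nim_value (n, k))" if "P m" for m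
  proof (cases "m \<ge> 0")
    case True
    then obtain l where "m = int l"
      using nonneg_int_cases by blast
    with \<open>P m\<close> show ?thesis
      by (simp add: P_iff)
  qed simp
  with P_iff show ?thesis
    by blast
qed

end
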